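(* Let $S\in\mathcal{B}([0,2\pi))$ be open on the circle and non-empty. Then the shrinkage kernel $Q_S$ is reversible with respect to the uniform distribution $\mathcal{U}_S$ on $S$, i.e. for all Borel sets $F,G\subseteq S$, $$\int_G Q_S(\theta,F)\,\mathcal{U}_S(\mathrm{d}\theta)=\int_F Q_S(\theta,G)\,\mathcal{U}_S(\mathrm{d}\theta).$$
   Context: Generalized intervals: for $\alpha,\beta\in[0,2\pi)$, $I(\alpha,\beta)=[\alpha,\beta)$ if $\alpha<\beta$, $I(\alpha,\beta)=[0,\beta)\cup[\alpha,2\pi)$ if $\alpha>\beta$, $I(\alpha,\alpha)=[0,2\pi)$; and $J(\alpha,\beta)=I(\alpha,\beta)$ if $\alpha\ne\beta$, $J(\alpha,\alpha)=\emptyset$. $\mathcal{U}_I$ denotes the uniform distribution on a bounded Borel set $I\subset\mathbb{R}$ of positive Lebesgue measure, and $\delta_v$ the Dirac measure at $v$. A set $S\in\mathcal{B}([0,2\pi))$ is open on the circle if for every $\theta\in S$ there is $\varepsilon\in(0,\pi)$ with $I(\theta-\varepsilon \bmod 2\pi,\ \theta+\varepsilon\bmod 2\pi)\subseteq S$; equivalently, $S$ corresponds to an open set under the natural bijection between $[0,2\pi)$ and the unit circle. Shrinkage chain: for $\theta\in[0,2\pi)$ let $\Lambda_\theta=\{(\gamma,\gamma^{\min},\gamma^{\max})\in[0,2\pi)^3:\gamma,\theta\in I(\gamma^{\min},\gamma^{\max}),\ \gamma\ne\theta\}$ and, for $z=(\gamma,\gamma^{\min},\gamma^{\max})\in\Lambda_\theta$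 and $D\in\mathcal{B}([0,2\pi)^3)$, $$R_\theta(z,D)=\mathbf{1}_{J(\gamma^{\min},\theta)}(\gamma)\,\bigl(\mathcal{U}_{I(\gamma,\gamma^{\max})}\otimes\delta_{(\gamma,\gamma^{\max})}\bigr)(D)+\mathbf{1}_{I(\theta,\gamma^{\max})}(\gamma)\,\bigl(\mathcal{U}_{I(\gamma^{\min},\gamma)}\otimes\delta_{(\gamma^{\min},\gamma)}\bigr)(D).$$ This is a Markov kernel with $R_\theta(z,\Lambda_\theta)=1$. Let $\mathbb{P}(\cdot\mid\Theta=\theta)$ be the law under which $(Z_n)_{n\in\mathbb{N}}$, $Z_n=(\Gamma_n,\Gamma_n^{\min},\Gamma_n^{\max})$, is the Markov chain with transition kernel $R_\theta$ and initial law $\mathbb{P}_{Z_1}(D)=\int_0^{2\pi}\delta_{(\gamma,\gamma,\gamma)}(D)\frac{\mathrm{d}\gamma}{2\pi}$ (so $Z_1\in\Lambda_\theta$ almost surely). For $S\in\mathcal{B}([0,2\pi))$ let $\tau_S=\inf\{n\in\mathbb{N}:\Gamma_n\in S\}$ ($\inf\emptyset=\infty$). Shrinkage kernel: for $\theta\in S$ and Borel $F\subseteq S$, $Q_S(\theta,F)=\mathbb{P}(\Gamma_{\tau_S}\in F,\ \tau_S<\infty\mid\Theta=\theta)$. *)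

theory Defs
  imports "HOL-Probability.Probability" "HOL-Library.Real_Mod"
begin

definition circ_I :: "real \<Rightarrow> real \<Rightarrow> real set" where
  "circ_I \<alpha> \<beta> =
    (if \<alpha> < \<beta> then {\<alpha>..<\<beta>}
     else if \<alpha> > \<beta> then {0..<\<beta>} \<union> {\<alpha>..<2 * pi}
     else {0..<2 * pi})"

definition circ_J :: "real \<Rightarrow> real \<Rightarrow> real set" where
  "circ_J \<alpha> \<beta> = (if \<alpha> \<noteq> \<beta> then circ_I \<alpha> \<beta> else {})"

definition open_on_circle :: "real set \<Rightarrow> bool" where
  "open_on_circle S \<longleftrightarrow>
    (\<forall>\<theta>\<in>S. \<exists>\<epsilon>\<in>{0<..<pi}. circ_I ((\<theta> - \<epsilon>) rmod (2 * pi)) ((\<theta> + \<epsilon>) rmod (2 * pi)) \<subseteq> S)"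

definition shrink_states :: "real \<Rightarrow> (real \<times> real \<times> real) set" where
  "shrink_states \<theta> = {(\<gamma>, \<gamma>min, \<gamma>max).
     \<gamma> \<in> {0..<2 * pi} \<and> \<gamma>min \<in> {0..<2 * pi} \<and> \<gamma>max \<in> {0..<2 * pi} \<and>
     \<gamma> \<in> circ_I \<gamma>min \<gamma>max \<and> \<theta> \<in> circ_I \<gamma>min \<gamma>max \<and> \<gamma> \<noteq> \<theta>}"

text \<open>
  Measures on \<open>[0, 2\<pi>)\<close> and \<open>[0, 2\<pi>)\<^sup>3\<close> are represented by measures on the ambient Borel spaces that
  are concentrated there. Outside \<^term>\<open>shrink_states \<theta>\<close>, a set the chain almost surely never
  enters, the kernel is extended by the identity so that it is a Markov kernel on the whole space.
\<close>

definition shrink_step :: "real \<Rightarrow> real \<times> real \<times> real \<Rightarrow> (real \<times> real \<times> real) measure" where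
  "shrink_step \<theta> z = (case z of (\<gamma>, \<gamma>min, \<gamma>max) \<Rightarrow>
     if z \<in> shrink_states \<theta>
     then measure_of UNIV (sets borel) (\<lambda>D.
       indicator (circ_J \<gamma>min \<theta>) \<gamma> *
         emeasure (uniform_measure lborel (circ_I \<gamma> \<gamma>max) \<Otimes>\<^sub>M return borel (\<gamma>, \<gamma>max)) D +
       indicator (circ_I \<theta> \<gamma>max) \<gamma> *
         emeasure (uniform_measure lborel (circ_I \<gamma>min \<gamma>) \<Otimes>\<^sub>M return borel (\<gamma>min, \<gamma>)) D)
     else return borel z)"

definition shrink_init :: "(real \<times> real \<times> real) measure" where
  "shrink_init = uniform_measure lborel {0..<2 * pi} \<bind> (\<lambda>\<gamma>. return borel (\<gamma>, \<gamma>, \<gamma>))"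

text \<open>
  The law on path space of the Markov chain with initial law \<open>\<mu>\<close> and transition kernel \<open>K\<close>, as the
  Ionescu-Tulcea limit; it is characterised by \<open>markov_law_initial\<close> and \<open>markov_law_step\<close> below.
\<close>

definition markov_trans ::
    "'a measure \<Rightarrow> ('a \<Rightarrow> 'a measure) \<Rightarrow> nat \<Rightarrow> (nat \<Rightarrow> 'a) \<Rightarrow> 'a measure" where
  "markov_trans \<mu> K n \<omega> = (case n of 0 \<Rightarrow> \<mu> | Suc m \<Rightarrow> K (\<omega> m))"

definition markov_law :: "'a measure \<Rightarrow> ('a \<Rightarrow> 'a measure) \<Rightarrow> (nat \<Rightarrow> 'a) measure" where
  "markov_law \<mu> K =
    projective_family.lim UNIV (Ionescu_Tulcea.CI (markov_trans \<mu> K) (\<lambda>_. \<mu>)) (\<lambda>_. \<mu>)"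

definition shrink_law :: "real \<Rightarrow> (nat \<Rightarrow> real \<times> real \<times> real) measure" where
  "shrink_law \<theta> = markov_law shrink_init (shrink_step \<theta>)"

text \<open>
  Time starts at \<open>1\<close>, whereas path coordinates start at \<open>0\<close>: \<open>Z\<^sub>n\<close> is coordinate \<open>n - 1\<close>.
\<close>

definition shrink_Gamma :: "nat \<Rightarrow> (nat \<Rightarrow> real \<times> real \<times> real) \<Rightarrow> real" where
  "shrink_Gamma n \<omega> = fst (\<omega> (n - 1))"

definition shrink_tau :: "real set \<Rightarrow> (nat \<Rightarrow> real \<times> real \<times> real) \<Rightarrow> enat" where
  "shrink_tau S \<omega> = Inf {enat n | n. 1 \<le> n \<and> shrink_Gamma n \<omega> \<in> S}"

definition shrink_kernel :: "real set \<Rightarrow> real \<Rightarrow> real set \<Rightarrow> ennreal" where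
  "shrink_kernel S \<theta> F = emeasure (shrink_law \<theta>)
     {\<omega> \<in> space (shrink_law \<theta>).
        shrink_Gamma (the_enat (shrink_tau S \<omega>)) \<omega> \<in> F \<and> shrink_tau S \<omega> < \<infinity>}"


subsection \<open>The laws above are well defined\<close>

lemma Ionescu_Tulcea_markov_trans:
  assumes "prob_space \<mu>" and K: "K \<in> measurable \<mu> (subprob_algebra \<mu>)"
    and "\<And>x. x \<in> space \<mu> \<Longrightarrow> prob_space (K x)"
  shows "Ionescu_Tulcea (markov_trans \<mu> K) (\<lambda>_. \<mu>)"
proof (rule Ionescu_Tulcea.intro)
  fix i :: nat
  show "markov_trans \<mu> K i \<in> measurable (PiM {0..<i} (\<lambda>_. \<mu>)) (subprob_algebra \<mu>)"
  proof (cases i)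
    case 0
    then show ?thesis
      using assms(1) by (auto simp: markov_trans_def[abs_def] space_subprob_algebra
          intro!: measurable_const prob_space_imp_subprob_space)
  next
    case (Suc m)
    have "(\<lambda>\<omega>. \<omega> m) \<in> measurable (PiM {0..<i} (\<lambda>_. \<mu>)) \<mu>"
      using Suc by (intro measurable_component_singleton) auto
    from measurable_compose[OF this K] show ?thesis
      using Suc by (simp add: markov_trans_def[abs_def])
  qed
  show "prob_space (markov_trans \<mu> K i x)" if "x \<in> space (PiM {0..<i} (\<lambda>_. \<mu>))" for x
    using assms that by (cases i) (auto simp: markov_trans_def space_PiM PiE_iff)
qed

context
  fixes \<mu> :: "'a measure" and K :: "'a \<Rightarrow> 'a measure"
  assumes \<mu>: "prob_space \<mu>" and K[measurable]: "K \<in> measurable \<mu> (subprob_algebra \<mu>)"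
    and prob_K: "\<And>x. x \<in> space \<mu> \<Longrightarrow> prob_space (K x)"
begin

interpretation IT: Ionescu_Tulcea "markov_trans \<mu> K" "\<lambda>_. \<mu>"
  by (rule Ionescu_Tulcea_markov_trans[OF \<mu> K prob_K])

lemma sets_markov_law: "sets (markov_law \<mu> K) = sets (PiM UNIV (\<lambda>_. \<mu>))"
  by (simp add: markov_law_def)

lemma space_markov_law: "space (markov_law \<mu> K) = space (PiM UNIV (\<lambda>_. \<mu>))"
  by (simp add: markov_law_def)

lemma distr_markov_law:
  "distr (markov_law \<mu> K) (PiM {0..<n} (\<lambda>_. \<mu>)) (\<lambda>\<omega>. restrict \<omega> {0..<n}) = IT.C 0 n (\<lambda>_. undefined)"
proof -
  have up: "IT.up_to {0..<n} = n"
    unfolding IT.up_to_def by (rule Least_equality) (auto simp: not_less[symmetric])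
  have "distr (markov_law \<mu> K) (PiM {0..<n} (\<lambda>_. \<mu>)) (\<lambda>\<omega>. restrict \<omega> {0..<n}) = IT.CI {0..<n}"
    unfolding markov_law_def by (rule IT.distr_lim) simp
  also have "\<dots> = IT.C 0 n (\<lambda>_. undefined)"
    using IT.distr_C[of n n "\<lambda>_. undefined" 0] by (simp add: IT.CI_def up)
  finally show ?thesis .
qed

lemma prob_space_markov_law: "prob_space (markov_law \<mu> K)"
proof (rule prob_space_distrD)
  show "(\<lambda>\<omega>. restrict \<omega> {0..<0}) \<in> measurable (markov_law \<mu> K) (PiM {0..<0} (\<lambda>_. \<mu>))"
    by (simp add: measurable_cong_sets[OF sets_markov_law refl] measurable_restrict_subset)
  show "prob_space (distr (markov_law \<mu> K) (PiM {0..<0} (\<lambda>_. \<mu>)) (\<lambda>\<omega>. restrict \<omega> {0..<0}))"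
    unfolding distr_markov_law by (rule IT.prob_space_C) simp
qed

lemma markov_law_Suc:
  assumes A[measurable]: "A \<in> sets (PiM {0..<n} (\<lambda>_. \<mu>))" and B[measurable]: "B \<in> sets \<mu>"
  shows "emeasure (markov_law \<mu> K)
      {\<omega> \<in> space (markov_law \<mu> K). restrict \<omega> {0..<n} \<in> A \<and> \<omega> n \<in> B} =
    (\<integral>\<^sup>+\<omega>. indicator A (restrict \<omega> {0..<n}) * emeasure (markov_trans \<mu> K n (restrict \<omega> {0..<n})) B
       \<partial>markov_law \<mu> K)"
proof -
  let ?M = "\<lambda>_::nat. \<mu>" and ?L = "markov_law \<mu> K"
  note [measurable_cong] = sets_markov_law
  define D where "D = {\<omega> \<in> space (PiM {0..<Suc n} ?M). restrict \<omega> {0..<n} \<in> A \<and> \<omega> n \<in> B}"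
  have r[measurable]: "(\<lambda>\<omega>. restrict \<omega> {0..<n}) \<in> measurable (PiM {0..<Suc n} ?M) (PiM {0..<n} ?M)"
    by (rule measurable_restrict_subset) auto
  have c[measurable]: "(\<lambda>\<omega>. \<omega> n) \<in> measurable (PiM {0..<Suc n} ?M) \<mu>"
    by (rule measurable_component_singleton) auto
  have D[measurable]: "D \<in> sets (PiM {0..<Suc n} ?M)"
    unfolding D_def by measurable
  have rL: "(\<lambda>\<omega>. restrict \<omega> {0..<k}) \<in> measurable ?L (PiM {0..<k} ?M)" for k
    by (simp add: measurable_cong_sets[OF sets_markov_law refl] measurable_restrict_subset)
  have "{\<omega> \<in> space ?L. restrict \<omega> {0..<n} \<in> A \<and> \<omega> n \<in> B} =
      (\<lambda>\<omega>. restrict \<omega> {0..<Suc n}) -` D \<inter> space ?L"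
    by (auto simp: D_def space_markov_law space_PiM PiE_iff Int_absorb1 Int_absorb2 min_def
        restrict_restrict)
  then have "emeasure ?L {\<omega> \<in> space ?L. restrict \<omega> {0..<n} \<in> A \<and> \<omega> n \<in> B} =
      emeasure (distr ?L (PiM {0..<Suc n} ?M) (\<lambda>\<omega>. restrict \<omega> {0..<Suc n})) D"
    by (simp add: emeasure_distr[OF rL D])
  also have "\<dots> = emeasure (IT.C 0 n (\<lambda>_. undefined) \<bind> IT.eP n) D"
    by (subst distr_markov_law) simp
  also have "\<dots> = (\<integral>\<^sup>+\<omega>. emeasure (IT.eP n \<omega>) D \<partial>IT.C 0 n (\<lambda>_. undefined))"
  proof (rule emeasure_bind[OF _ _ D])
    show "space (IT.C 0 n (\<lambda>_. undefined)) \<noteq> {}"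
      by (rule prob_space.not_empty[OF IT.prob_space_C]) simp
    show "IT.eP n \<in> measurable (IT.C 0 n (\<lambda>_. undefined)) (subprob_algebra (PiM {0..<Suc n} ?M))"
      using IT.measurable_eP[of n] by (simp add: measurable_cong_sets[OF IT.sets_C refl])
  qed
  also have "\<dots> = (\<integral>\<^sup>+\<omega>. indicator A \<omega> * emeasure (markov_trans \<mu> K n \<omega>) B \<partial>IT.C 0 n (\<lambda>_. undefined))"
  proof (rule nn_integral_cong)
    fix \<omega> assume "\<omega> \<in> space (IT.C 0 n (\<lambda>_. undefined))"
    then have \<omega>: "\<omega> \<in> space (PiM {0..<n} ?M)" by (simp add: IT.space_C)
    have "(\<lambda>x. fun_upd \<omega> n x) -` D \<inter> space \<mu> = (if \<omega> \<in> A then B else {})"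
    proof -
      have 1: "restrict (fun_upd \<omega> n x) {0..<n} = \<omega>" for x
        using \<omega> by (auto simp: space_PiM PiE_iff extensional_def fun_eq_iff)
      have 2: "fun_upd \<omega> n x \<in> space (PiM {0..<Suc n} ?M)" if "x \<in> space \<mu>" for x
        using \<omega> that by (auto simp: space_PiM PiE_iff extensional_def)
      show ?thesis
        using 2 sets.sets_into_space[OF B] by (auto simp: D_def 1)
    qed
    then show "emeasure (IT.eP n \<omega>) D = indicator A \<omega> * emeasure (markov_trans \<mu> K n \<omega>) B"
      by (simp add: IT.emeasure_eP[OF \<omega> D])
  qed
  also have "\<dots> = (\<integral>\<^sup>+\<omega>. indicator A \<omega> * emeasure (markov_trans \<mu> K n \<omega>) B
      \<partial>distr ?L (PiM {0..<n} ?M) (\<lambda>\<omega>. restrict \<omega> {0..<n}))"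
    by (simp add: distr_markov_law)
  also have "\<dots> = (\<integral>\<^sup>+\<omega>. indicator A (restrict \<omega> {0..<n}) *
      emeasure (markov_trans \<mu> K n (restrict \<omega> {0..<n})) B \<partial>?L)"
    using IT.P[of n] by (subst nn_integral_distr[OF rL]) auto
  finally show ?thesis .
qed

lemma markov_law_initial:
  assumes B: "B \<in> sets \<mu>"
  shows "emeasure (markov_law \<mu> K) {\<omega> \<in> space (markov_law \<mu> K). \<omega> 0 \<in> B} = emeasure \<mu> B"
proof -
  have "{\<lambda>_. undefined} \<in> sets (PiM {0..<0::nat} (\<lambda>_. \<mu>))"
    using sets_PiM_empty by auto
  from markov_law_Suc[OF this B] show ?thesis
    using prob_space.emeasure_space_1[OF prob_space_markov_law]
    by (simp add: markov_trans_def restrict_def)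
qed

lemma markov_law_step:
  assumes A: "A \<in> sets (PiM {0..<Suc n} (\<lambda>_. \<mu>))" and B: "B \<in> sets \<mu>"
  shows "emeasure (markov_law \<mu> K)
      {\<omega> \<in> space (markov_law \<mu> K). restrict \<omega> {0..<Suc n} \<in> A \<and> \<omega> (Suc n) \<in> B} =
    (\<integral>\<^sup>+\<omega>. indicator A (restrict \<omega> {0..<Suc n}) * emeasure (K (\<omega> n)) B \<partial>markov_law \<mu> K)"
  using markov_law_Suc[OF A B] by (simp add: markov_trans_def)

end

lemma sets_circ_I[measurable]: "circ_I \<alpha> \<beta> \<in> sets borel"
  by (auto simp: circ_I_def)

lemma sets_circ_J[measurable]: "circ_J \<alpha> \<beta> \<in> sets borel"
  by (auto simp: circ_J_def)

lemma emeasure_circ_I: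
  assumes "\<alpha> \<in> {0..<2 * pi}" "\<beta> \<in> {0..<2 * pi}"
  shows "emeasure lborel (circ_I \<alpha> \<beta>) \<noteq> 0" "emeasure lborel (circ_I \<alpha> \<beta>) \<noteq> \<infinity>"
proof -
  have *: "\<exists>a b. a < b \<and> {a..<b} \<subseteq> circ_I \<alpha> \<beta> \<and> circ_I \<alpha> \<beta> \<subseteq> {0..<2 * pi}"
  proof (cases "\<alpha> < \<beta>")
    case True
    then show ?thesis using assms by (intro exI[of _ \<alpha>] exI[of _ \<beta>]) (auto simp: circ_I_def)
  next
    case False
    then show ?thesis using assms by (intro exI[of _ \<alpha>] exI[of _ "2 * pi"]) (auto simp: circ_I_def)
  qed
  then obtain a b where ab: "a < b" "{a..<b} \<subseteq> circ_I \<alpha> \<beta>" "circ_I \<alpha> \<beta> \<subseteq> {0..<2 * pi}" by blast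
  have "emeasure lborel {a..<b} \<le> emeasure lborel (circ_I \<alpha> \<beta>)"
    using ab by (intro emeasure_mono) auto
  then show "emeasure lborel (circ_I \<alpha> \<beta>) \<noteq> 0"
    using ab(1) by (auto simp: ennreal_eq_0_iff)
  have "emeasure lborel (circ_I \<alpha> \<beta>) \<le> emeasure lborel {0..<2 * pi}"
    using ab by (intro emeasure_mono) auto
  then show "emeasure lborel (circ_I \<alpha> \<beta>) \<noteq> \<infinity>"
    by (auto simp: top_unique)
qed

lemma prob_space_unif_circ_I:
  assumes "\<alpha> \<in> {0..<2 * pi}" "\<beta> \<in> {0..<2 * pi}"
  shows "prob_space (uniform_measure lborel (circ_I \<alpha> \<beta>))"
  by (rule prob_space_uniform_measure) (use emeasure_circ_I[OF assms] in auto)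

lemma sets_borel_triple:
  "sets (borel :: (real \<times> real \<times> real) measure) = sets (borel \<Otimes>\<^sub>M borel)"
  by (simp only: borel_prod)

lemma sets_shrink_step[simp, measurable_cong]: "sets (shrink_step \<theta> z) = sets borel"
  by (auto simp: shrink_step_def split: prod.split)
     (metis sets.sigma_sets_eq sets_measure_of space_borel subset_UNIV Pow_UNIV)+

lemma space_shrink_step[simp]: "space (shrink_step \<theta> z) = UNIV"
  using sets_eq_imp_space_eq[OF sets_shrink_step] by simp

lemma sets_step_component[simp]:
  "sets (uniform_measure lborel (A :: real set) \<Otimes>\<^sub>M return (borel :: (real \<times> real) measure) y) = sets borel"
  unfolding sets_borel_triple by (intro sets_pair_measure_cong) auto

lemma emeasure_shrink_step:
  assumes z: "(\<gamma>, \<gamma>min, \<gamma>max) \<in> shrink_states \<theta>" and D: "D \<in> sets borel"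
  shows "emeasure (shrink_step \<theta> (\<gamma>, \<gamma>min, \<gamma>max)) D =
       indicator (circ_J \<gamma>min \<theta>) \<gamma> *
         emeasure (uniform_measure lborel (circ_I \<gamma> \<gamma>max) \<Otimes>\<^sub>M return borel (\<gamma>, \<gamma>max)) D +
       indicator (circ_I \<theta> \<gamma>max) \<gamma> *
         emeasure (uniform_measure lborel (circ_I \<gamma>min \<gamma>) \<Otimes>\<^sub>M return borel (\<gamma>min, \<gamma>)) D"
    (is "_ = ?i * emeasure ?M D + ?j * emeasure ?N D")
proof -
  let ?f = "\<lambda>D. ?i * emeasure ?M D + ?j * emeasure ?N D"
  have "shrink_step \<theta> (\<gamma>, \<gamma>min, \<gamma>max) = measure_of UNIV (sets borel) ?f"
    using z by (simp add: shrink_step_def)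
  moreover have "emeasure (measure_of UNIV (sets borel) ?f) D = ?f D"
  proof (rule emeasure_measure_of_sigma)
    show "sigma_algebra UNIV (sets (borel :: (real \<times> real \<times> real) measure))"
      using sets.sigma_algebra_axioms[of borel] by simp
    show "positive (sets borel) ?f"
      by (simp add: positive_def)
    show "countably_additive (sets borel) ?f"
    proof (rule countably_additiveI)
      fix A :: "nat \<Rightarrow> (real \<times> real \<times> real) set"
      assume A: "range A \<subseteq> sets borel" "disjoint_family A"
      have "(\<Sum>i. emeasure ?M (A i)) = emeasure ?M (\<Union>i. A i)"
        "(\<Sum>i. emeasure ?N (A i)) = emeasure ?N (\<Union>i. A i)"
        using A by (intro suminf_emeasure; simp only: sets_step_component)+
      then show "(\<Sum>i. ?f (A i)) = ?f (\<Union>i. A i)"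
        by (simp add: suminf_add[symmetric])
    qed
  qed fact
  ultimately show ?thesis by simp
qed

lemma circ_split:
  assumes "(\<gamma>, \<gamma>min, \<gamma>max) \<in> shrink_states \<theta>"
  shows "\<gamma> \<in> circ_I \<theta> \<gamma>max \<longleftrightarrow> \<gamma> \<notin> circ_J \<gamma>min \<theta>"
  using assms by (auto simp: shrink_states_def circ_I_def circ_J_def split: if_splits)

lemma emeasure_step_component:
  fixes y :: "real \<times> real" and A :: "real set"
  assumes D: "D \<in> sets borel" and A[measurable]: "A \<in> sets borel"
  shows "emeasure (uniform_measure lborel A \<Otimes>\<^sub>M return borel y) D =
    (\<integral>\<^sup>+x. indicator A x * indicator D (x, y) \<partial>lborel) / emeasure lborel A"
proof -
  interpret R: prob_space "return borel y" by (rule prob_space_return) simp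
  have D'[measurable]: "D \<in> sets (borel \<Otimes>\<^sub>M borel)"
    using D by (simp only: sets_borel_triple)
  have "emeasure (uniform_measure lborel A \<Otimes>\<^sub>M return borel y) D =
      (\<integral>\<^sup>+x. emeasure (return borel y) (Pair x -` D) \<partial>uniform_measure lborel A)"
    using D by (intro R.emeasure_pair_measure_alt) simp
  also have "\<dots> = (\<integral>\<^sup>+x. indicator D (x, y) \<partial>uniform_measure lborel A)"
    using sets_Pair1[OF D'] by (intro nn_integral_cong) (auto simp: indicator_def)
  also have "\<dots> = (\<integral>\<^sup>+x. indicator D (x, y) * indicator A x \<partial>lborel) / emeasure lborel A"
    by (rule nn_integral_uniform_measure) measurable
  finally show ?thesis by (simp add: mult.commute)
qed

lemma prob_space_shrink_step: "prob_space (shrink_step \<theta> z)"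
proof (cases z)
  case (fields \<gamma> \<gamma>min \<gamma>max)
  show ?thesis
  proof (cases "z \<in> shrink_states \<theta>")
    case False
    then show ?thesis
      using fields by (simp add: shrink_step_def prob_space_return)
  next
    case True
    have g: "\<gamma> \<in> {0..<2 * pi}" "\<gamma>min \<in> {0..<2 * pi}" "\<gamma>max \<in> {0..<2 * pi}"
      using True fields by (auto simp: shrink_states_def)
    have *: "emeasure (uniform_measure lborel (circ_I a b) \<Otimes>\<^sub>M return borel y) UNIV = 1"
      if "a \<in> {0..<2 * pi}" "b \<in> {0..<2 * pi}" for a b and y :: "real \<times> real"
      using emeasure_circ_I[OF that] by (simp add: emeasure_step_component ennreal_divide_self less_top)
    show ?thesis
    proof
      show "emeasure (shrink_step \<theta> z) (space (shrink_step \<theta> z)) = 1"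
        using True circ_split[of \<gamma> \<gamma>min \<gamma>max \<theta>] g
        by (simp add: fields emeasure_shrink_step * indicator_def)
    qed
  qed
qed

lemma pred_circ_I[measurable (raw)]:
  assumes [measurable]: "f \<in> borel_measurable M" "g \<in> borel_measurable M" "h \<in> borel_measurable M"
  shows "Measurable.pred M (\<lambda>x. f x \<in> circ_I (g x) (h x))"
proof -
  have "(\<lambda>x. f x \<in> circ_I (g x) (h x)) = (\<lambda>x.
      if g x < h x then g x \<le> f x \<and> f x < h x
      else if h x < g x then (0 \<le> f x \<and> f x < h x) \<or> (g x \<le> f x \<and> f x < 2 * pi)
      else 0 \<le> f x \<and> f x < 2 * pi)"
    by (auto simp: circ_I_def fun_eq_iff)
  then show ?thesis by simp
qed

lemma pred_circ_J[measurable (raw)]: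
  assumes [measurable]: "f \<in> borel_measurable M" "g \<in> borel_measurable M" "h \<in> borel_measurable M"
  shows "Measurable.pred M (\<lambda>x. f x \<in> circ_J (g x) (h x))"
proof -
  have "(\<lambda>x. f x \<in> circ_J (g x) (h x)) = (\<lambda>x. g x \<noteq> h x \<and> f x \<in> circ_I (g x) (h x))"
    by (auto simp: circ_J_def fun_eq_iff)
  then show ?thesis by simp
qed

lemma measurable_step_component[measurable (raw)]:
  assumes D: "D \<in> sets borel"
    and [measurable]: "f \<in> borel_measurable M" "g \<in> borel_measurable M" "h \<in> measurable M borel"
  shows "(\<lambda>x. emeasure (uniform_measure lborel (circ_I (f x) (g x)) \<Otimes>\<^sub>M
            return (borel :: (real \<times> real) measure) (h x)) D) \<in> borel_measurable M"
proof -
  have [measurable]: "D \<in> sets (borel \<Otimes>\<^sub>M borel)"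
    using D by (simp only: sets_borel_triple)
  have *: "emeasure lborel (circ_I a b) = (\<integral>\<^sup>+x. indicator (circ_I a b) x \<partial>lborel)" for a b
    by simp
  show ?thesis
    unfolding emeasure_step_component[OF D sets_circ_I] *
    by measurable
qed

lemma sets_shrink_states[measurable]: "shrink_states \<theta> \<in> sets borel"
proof -
  have "shrink_states \<theta> = {z \<in> space (borel \<Otimes>\<^sub>M (borel \<Otimes>\<^sub>M borel)).
     fst z \<in> {0..<2 * pi} \<and> fst (snd z) \<in> {0..<2 * pi} \<and> snd (snd z) \<in> {0..<2 * pi} \<and>
     fst z \<in> circ_I (fst (snd z)) (snd (snd z)) \<and> \<theta> \<in> circ_I (fst (snd z)) (snd (snd z)) \<and>
     fst z \<noteq> \<theta>}"
    by (auto simp: shrink_states_def space_pair_measure)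
  also have "\<dots> \<in> sets (borel \<Otimes>\<^sub>M (borel \<Otimes>\<^sub>M borel))"
    by measurable
  finally show ?thesis by (simp only: borel_prod)
qed

lemma measurable_shrink_step: "shrink_step \<theta> \<in> measurable borel (subprob_algebra borel)"
proof (rule measurable_subprob_algebra)
  show "subprob_space (shrink_step \<theta> z)" for z
    by (rule prob_space_imp_subprob_space[OF prob_space_shrink_step])
  fix D :: "(real \<times> real \<times> real) set" assume D[measurable]: "D \<in> sets borel"
  have [measurable]: "fst \<in> borel_measurable (borel :: (real \<times> real \<times> real) measure)"
    "(\<lambda>z. fst (snd z)) \<in> borel_measurable (borel :: (real \<times> real \<times> real) measure)"
    "(\<lambda>z. snd (snd z)) \<in> borel_measurable (borel :: (real \<times> real \<times> real) measure)"
    by (auto intro!: borel_measurable_continuous_onI continuous_intros)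
  let ?a = "fst :: real \<times> real \<times> real \<Rightarrow> real" and ?b = "\<lambda>z :: real \<times> real \<times> real. fst (snd z)"
    and ?c = "\<lambda>z :: real \<times> real \<times> real. snd (snd z)"
  have "(\<lambda>z. emeasure (shrink_step \<theta> z) D) = (\<lambda>z. if z \<in> shrink_states \<theta>
     then indicator (circ_J (?b z) \<theta>) (?a z) *
         emeasure (uniform_measure lborel (circ_I (?a z) (?c z)) \<Otimes>\<^sub>M return borel (?a z, ?c z)) D +
       indicator (circ_I \<theta> (?c z)) (?a z) *
         emeasure (uniform_measure lborel (circ_I (?b z) (?a z)) \<Otimes>\<^sub>M return borel (?b z, ?a z)) D
     else indicator D z)"
    by (auto simp: fun_eq_iff emeasure_shrink_step D) (simp add: shrink_step_def)
  also have "\<dots> \<in> borel_measurable borel"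
    by measurable
  finally show "(\<lambda>z. emeasure (shrink_step \<theta> z) D) \<in> borel_measurable borel" .
qed simp

lemma measurable_diag: "(\<lambda>\<gamma>. return borel (\<gamma>, \<gamma>, \<gamma>)) \<in>
    measurable (uniform_measure lborel {0..<2 * pi}) (subprob_algebra (borel :: (real \<times> real \<times> real) measure))"
proof -
  have "(\<lambda>\<gamma>::real. (\<gamma>, \<gamma>, \<gamma>)) \<in> borel_measurable borel"
    by (intro borel_measurable_continuous_onI continuous_intros)
  from measurable_compose[OF this return_measurable] show ?thesis
    by (simp cong: measurable_cong_sets)
qed

lemma sets_shrink_init[simp, measurable_cong]: "sets shrink_init = sets borel"
  unfolding shrink_init_def by (rule sets_bind) auto

lemma prob_space_shrink_init: "prob_space shrink_init"
proof -
  have "prob_space (uniform_measure lborel {0..<2 * pi})"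
    using prob_space_unif_circ_I[of 0 0] by (simp add: circ_I_def)
  then show ?thesis
    unfolding shrink_init_def
    by (rule prob_space.prob_space_bind[OF _ _ measurable_diag]) (auto intro!: prob_space_return)
qed

lemma shrink_chain_wf:
  shows "prob_space shrink_init"
    and "shrink_step \<theta> \<in> measurable shrink_init (subprob_algebra shrink_init)"
    and "z \<in> space shrink_init \<Longrightarrow> prob_space (shrink_step \<theta> z)"
  using measurable_shrink_step[of \<theta>] prob_space_shrink_init prob_space_shrink_step
  by (simp_all add: subprob_algebra_cong[OF sets_shrink_init] cong: measurable_cong_sets)

lemmas shrink_law_initial = markov_law_initial[OF shrink_chain_wf, folded shrink_law_def]
  and shrink_law_step = markov_law_step[OF shrink_chain_wf, folded shrink_law_def]
  and prob_space_shrink_law = prob_space_markov_law[OF shrink_chain_wf, folded shrink_law_def]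

end

theory Submission
  imports Defs
begin

text \<open>
  By the Markov property, \<open>Q\<^sub>S(\<theta>, F)\<close> is a sum over the number \<open>n\<close> of rejected angles of iterated
  integrals over these angles in the complement of \<open>S\<close>. A rejected angle \<open>\<gamma>\<close> cuts the current
  interval \<open>I(a, b)\<close> into \<open>I(a, \<gamma>)\<close> and \<open>I(\<gamma>, b)\<close>, and the chain continues with the piece containing
  \<open>\<theta>\<close>. Exchanging the integrations over \<open>\<theta>\<close> and \<open>\<gamma>\<close> therefore splits the integral over
  \<open>\<theta> \<in> G \<inter> I(a, b)\<close> into the corresponding integrals over the two pieces with one rejection fewer.
  Without rejections the integral is \<open>|F \<inter> I(a, b)| |G \<inter> I(a, b)| / |I(a, b)|\<close>, so each summand is
  symmetric in \<open>F\<close> and \<open>G\<close> by induction on \<open>n\<close>.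
\<close>

section \<open>Killed Markov chains\<close>

text \<open>\<open>markov_law_step\<close> is the case of an indicator \<open>f\<close>. Both sides
  are linear in \<open>f\<close> and commute with increasing suprema, so induction over measurable
  functions extends it. \<open>A\<close> is an arbitrary event of the past up to time
  \<open>n\<close>.\<close>

lemma nn_integral_markov_law_step:
  assumes \<mu>: "prob_space \<mu>" and K[measurable]: "K \<in> measurable \<mu> (subprob_algebra \<mu>)"
    and prob_K: "\<And>x. x \<in> space \<mu> \<Longrightarrow> prob_space (K x)"
    and A[measurable]: "A \<in> sets (PiM {0..<Suc n} (\<lambda>_. \<mu>))" and f: "f \<in> borel_measurable \<mu>"
  shows "(\<integral>\<^sup>+\<omega>. indicator A (restrict \<omega> {0..<Suc n}) * f (\<omega> (Suc n)) \<partial>markov_law \<mu> K) =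
    (\<integral>\<^sup>+\<omega>. indicator A (restrict \<omega> {0..<Suc n}) * (\<integral>\<^sup>+y. f y \<partial>K (\<omega> n)) \<partial>markov_law \<mu> K)"
proof -
  let ?L = "markov_law \<mu> K"
  have sp: "space ?L = space (PiM UNIV (\<lambda>_. \<mu>))"
    by (rule space_markov_law[OF \<mu> K prob_K])
  have setsL: "sets ?L = sets (PiM UNIV (\<lambda>_. \<mu>))"
    by (rule sets_markov_law[OF \<mu> K prob_K])
  note [measurable_cong] = setsL
  have [measurable]: "(\<lambda>\<omega>. restrict \<omega> {0..<Suc n}) \<in> measurable ?L (PiM {0..<Suc n} (\<lambda>_. \<mu>))"
    by (simp add: measurable_cong_sets[OF setsL refl] measurable_restrict_subset)
  have c[measurable]: "(\<lambda>\<omega>. \<omega> i) \<in> measurable ?L \<mu>" for i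
    by (simp add: measurable_cong_sets[OF setsL refl] measurable_component_singleton)
  have in_sp: "\<omega> i \<in> space \<mu>" if "\<omega> \<in> space ?L" for \<omega> i
    using that by (auto simp: sp space_PiM)
  have sK: "sets (K x) = sets \<mu>" if "x \<in> space \<mu>" for x
    using sets_kernel[OF K that] .
  have spK: "space (K x) = space \<mu>" if "x \<in> space \<mu>" for x
    using sets_eq_imp_space_eq[OF sK[OF that]] .
  have mK[measurable]: "(\<lambda>\<omega>. \<integral>\<^sup>+y. g y \<partial>K (\<omega> n)) \<in> borel_measurable ?L"
    if "g \<in> borel_measurable \<mu>" for g
    using measurable_compose[OF measurable_compose[OF c K] nn_integral_measurable_subprob_algebra[OF that]]
    by simp
  have gK: "g \<in> borel_measurable (K x)" if "g \<in> borel_measurable \<mu>" "x \<in> space \<mu>" for g :: "_ \<Rightarrow> ennreal" and x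
    using that(1) by (simp add: measurable_cong_sets[OF sK[OF that(2)] refl])
  show ?thesis
    using f
  proof (induction f rule: borel_measurable_induct)
    \<comment> \<open>\<open>f\<close> and \<open>g\<close> agree only on
      \<open>space \<mu>\<close>; all coordinates of a path lie there, and each
      \<open>K (\<omega> n)\<close> lives on it.\<close>
    case (cong f g)
    have eq1: "(\<integral>\<^sup>+\<omega>. indicator A (restrict \<omega> {0..<Suc n}) * f (\<omega> (Suc n)) \<partial>?L) =
        (\<integral>\<^sup>+\<omega>. indicator A (restrict \<omega> {0..<Suc n}) * g (\<omega> (Suc n)) \<partial>?L)"
      using cong(3) in_sp by (intro nn_integral_cong) auto
    have eq2: "(\<integral>\<^sup>+\<omega>. indicator A (restrict \<omega> {0..<Suc n}) * (\<integral>\<^sup>+y. f y \<partial>K (\<omega> n)) \<partial>?L) =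
        (\<integral>\<^sup>+\<omega>. indicator A (restrict \<omega> {0..<Suc n}) * (\<integral>\<^sup>+y. g y \<partial>K (\<omega> n)) \<partial>?L)"
      using cong(3) in_sp spK by (intro nn_integral_cong arg_cong2[where f="(*)"] refl) auto
    show ?case by (simp only: eq1 eq2 cong.IH)
  next
    case (set B)
    note [measurable] = set
    have "(\<integral>\<^sup>+\<omega>. indicator A (restrict \<omega> {0..<Suc n}) * indicator B (\<omega> (Suc n)) \<partial>?L) =
        (\<integral>\<^sup>+\<omega>. indicator {\<omega> \<in> space ?L. restrict \<omega> {0..<Suc n} \<in> A \<and> \<omega> (Suc n) \<in> B} \<omega> \<partial>?L)"
      by (intro nn_integral_cong) (auto simp: indicator_def)
    also have "\<dots> = emeasure ?L {\<omega> \<in> space ?L. restrict \<omega> {0..<Suc n} \<in> A \<and> \<omega> (Suc n) \<in> B}"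
      by (intro nn_integral_indicator) measurable
    also have "\<dots> = (\<integral>\<^sup>+\<omega>. indicator A (restrict \<omega> {0..<Suc n}) * emeasure (K (\<omega> n)) B \<partial>?L)"
      by (rule markov_law_step[OF \<mu> K prob_K A set])
    also have "\<dots> = (\<integral>\<^sup>+\<omega>. indicator A (restrict \<omega> {0..<Suc n}) * (\<integral>\<^sup>+y. indicator B y \<partial>K (\<omega> n)) \<partial>?L)"
      using set in_sp sK by (intro nn_integral_cong) (simp del: restrict_apply)
    finally show ?case .
  next
    case (mult u v)
    note [measurable] = mult(2)
    have "(\<integral>\<^sup>+\<omega>. indicator A (restrict \<omega> {0..<Suc n}) * (v * u (\<omega> (Suc n))) \<partial>?L) =
        v * (\<integral>\<^sup>+\<omega>. indicator A (restrict \<omega> {0..<Suc n}) * u (\<omega> (Suc n)) \<partial>?L)"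
      by (subst nn_integral_cmult[symmetric]) (auto simp: ac_simps)
    also have "\<dots> = (\<integral>\<^sup>+\<omega>. v * (indicator A (restrict \<omega> {0..<Suc n}) * (\<integral>\<^sup>+y. u y \<partial>K (\<omega> n))) \<partial>?L)"
      unfolding mult.IH using mK[OF mult(2)] by (subst nn_integral_cmult) auto
    also have "\<dots> = (\<integral>\<^sup>+\<omega>. indicator A (restrict \<omega> {0..<Suc n}) * (\<integral>\<^sup>+y. v * u y \<partial>K (\<omega> n)) \<partial>?L)"
      using in_sp by (intro nn_integral_cong) (simp add: nn_integral_cmult gK mult(2) ac_simps)
    finally show ?case .
  next
    case (add u v)
    note [measurable] = add(1) add(3)
    have "(\<integral>\<^sup>+\<omega>. indicator A (restrict \<omega> {0..<Suc n}) * (v (\<omega> (Suc n)) + u (\<omega> (Suc n))) \<partial>?L) =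
        (\<integral>\<^sup>+\<omega>. indicator A (restrict \<omega> {0..<Suc n}) * v (\<omega> (Suc n)) \<partial>?L) +
        (\<integral>\<^sup>+\<omega>. indicator A (restrict \<omega> {0..<Suc n}) * u (\<omega> (Suc n)) \<partial>?L)"
      by (subst nn_integral_add[symmetric]) (auto simp: distrib_left)
    also have "\<dots> = (\<integral>\<^sup>+\<omega>. indicator A (restrict \<omega> {0..<Suc n}) * (\<integral>\<^sup>+y. v y \<partial>K (\<omega> n)) +
        indicator A (restrict \<omega> {0..<Suc n}) * (\<integral>\<^sup>+y. u y \<partial>K (\<omega> n)) \<partial>?L)"
      unfolding add.IH using mK[OF add(1)] mK[OF add(3)] by (subst nn_integral_add) auto
    also have "\<dots> = (\<integral>\<^sup>+\<omega>. indicator A (restrict \<omega> {0..<Suc n}) * (\<integral>\<^sup>+y. v y + u y \<partial>K (\<omega> n)) \<partial>?L)"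
      using in_sp by (intro nn_integral_cong) (simp add: nn_integral_add gK add(1,3) distrib_left)
    finally show ?case .
  next
    \<comment> \<open>Monotone convergence enters three times: for the outer integral on either side
      and for the inner integral over \<open>K (\<omega> n)\<close>.\<close>
    case (seq U)
    note [measurable] = seq(1)
    have "(\<integral>\<^sup>+\<omega>. indicator A (restrict \<omega> {0..<Suc n}) * (SUP i. U i) (\<omega> (Suc n)) \<partial>?L) =
        (\<integral>\<^sup>+\<omega>. (SUP i. indicator A (restrict \<omega> {0..<Suc n}) * U i (\<omega> (Suc n))) \<partial>?L)"
      by (simp add: SUP_mult_left_ennreal image_comp)
    also have "\<dots> = (SUP i. \<integral>\<^sup>+\<omega>. indicator A (restrict \<omega> {0..<Suc n}) * U i (\<omega> (Suc n)) \<partial>?L)"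
      using seq(3) by (intro nn_integral_monotone_convergence_SUP)
        (auto simp: incseq_def le_fun_def intro!: mult_left_mono)
    also have "\<dots> = (\<integral>\<^sup>+\<omega>. (SUP i. indicator A (restrict \<omega> {0..<Suc n}) * (\<integral>\<^sup>+y. U i y \<partial>K (\<omega> n))) \<partial>?L)"
      unfolding seq.IH using seq(3) mK[OF seq(1)]
      by (intro nn_integral_monotone_convergence_SUP[symmetric])
        (auto simp: incseq_def le_fun_def intro!: mult_left_mono nn_integral_mono)
    also have "\<dots> = (\<integral>\<^sup>+\<omega>. indicator A (restrict \<omega> {0..<Suc n}) * (\<integral>\<^sup>+y. (SUP i. U i) y \<partial>K (\<omega> n)) \<partial>?L)"
      using in_sp seq(3)
      by (intro nn_integral_cong)
        (simp add: SUP_mult_left_ennreal nn_integral_monotone_convergence_SUP gK seq(1) image_comp)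
    finally show ?case .
  qed
qed

text \<open>The transition operator of the chain killed outside \<open>B\<close>. Killing looks at
  the starting point \<open>z\<close>, not at its successor, so the \<open>n\<close>-th power tests
  times 0 to n - 1 and leaves time \<open>n\<close> to \<open>f\<close>.\<close>

definition killed_op :: "('a \<Rightarrow> 'a measure) \<Rightarrow> 'a set \<Rightarrow> ('a \<Rightarrow> ennreal) \<Rightarrow> 'a \<Rightarrow> ennreal" where
  "killed_op K B f z = indicator B z * (\<integral>\<^sup>+y. f y \<partial>K z)"

lemma funpow_killed_op_Suc:
  "(killed_op K B ^^ Suc n) f z = indicator B z * (\<integral>\<^sup>+y. (killed_op K B ^^ n) f y \<partial>K z)"
  by (subst funpow.simps, subst o_apply, rule killed_op_def)

lemma measurable_killed_op:
  assumes "K \<in> measurable \<mu> (subprob_algebra \<mu>)" and [measurable]: "B \<in> sets \<mu>" and "f \<in> borel_measurable \<mu>"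
  shows "killed_op K B f \<in> borel_measurable \<mu>"
proof -
  have [measurable]: "(\<lambda>z. \<integral>\<^sup>+y. f y \<partial>K z) \<in> borel_measurable \<mu>"
    by (rule measurable_compose[OF assms(1) nn_integral_measurable_subprob_algebra[OF assms(3)]])
  show ?thesis unfolding killed_op_def[abs_def] by measurable
qed

text \<open>The induction peels off the last step: integrating out coordinate \<open>Suc n\<close>
  turns \<open>f\<close> into \<open>killed_op K B f\<close> at time \<open>n\<close>. Hence
  \<open>f\<close> varies in the induction.\<close>

lemma nn_integral_markov_law_killed:
  assumes \<mu>: "prob_space \<mu>" and K[measurable]: "K \<in> measurable \<mu> (subprob_algebra \<mu>)"
    and prob_K: "\<And>x. x \<in> space \<mu> \<Longrightarrow> prob_space (K x)"
    and B[measurable]: "B \<in> sets \<mu>" and f: "f \<in> borel_measurable \<mu>"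
  shows "(\<integral>\<^sup>+\<omega>. indicator {\<omega>. \<forall>i<n. \<omega> i \<in> B} \<omega> * f (\<omega> n) \<partial>markov_law \<mu> K) =
    (\<integral>\<^sup>+z. (killed_op K B ^^ n) f z \<partial>\<mu>)"
  using f
proof (induction n arbitrary: f)
  case 0
  let ?L = "markov_law \<mu> K"
  have setsL: "sets ?L = sets (PiM UNIV (\<lambda>_. \<mu>))"
    by (rule sets_markov_law[OF \<mu> K prob_K])
  have c: "(\<lambda>\<omega>. \<omega> 0) \<in> measurable ?L \<mu>"
    by (simp add: measurable_cong_sets[OF setsL refl] measurable_component_singleton)
  \<comment> \<open>At time 0 there is no survival condition, so it suffices that coordinate 0 has
    law \<open>\<mu>\<close>.\<close>
  have "distr ?L \<mu> (\<lambda>\<omega>. \<omega> 0) = \<mu>"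
  proof (rule measure_eqI)
    fix X assume "X \<in> sets (distr ?L \<mu> (\<lambda>\<omega>. \<omega> 0))"
    then have X: "X \<in> sets \<mu>" by simp
    have "(\<lambda>\<omega>. \<omega> 0) -` X \<inter> space ?L = {\<omega> \<in> space ?L. \<omega> 0 \<in> X}" by auto
    then show "emeasure (distr ?L \<mu> (\<lambda>\<omega>. \<omega> 0)) X = emeasure \<mu> X"
      using markov_law_initial[OF \<mu> K prob_K X] by (simp add: emeasure_distr[OF c X])
  qed simp
  then show ?case
    using nn_integral_distr[OF c, of f] 0 by simp
next
  case (Suc n)
  let ?A = "{x \<in> space (PiM {0..<Suc n} (\<lambda>_. \<mu>)). \<forall>i<Suc n. x i \<in> B}"
  let ?L = "markov_law \<mu> K"
  have [measurable]: "(\<lambda>x. x i) \<in> measurable (PiM {0..<Suc n} (\<lambda>_. \<mu>)) \<mu>" if "i \<in> {..<Suc n}" for i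
    using that by (intro measurable_component_singleton) auto
  have "?A = {x \<in> space (PiM {0..<Suc n} (\<lambda>_. \<mu>)). \<forall>i\<in>{..<Suc n}. x i \<in> B}" by auto
  also have "\<dots> \<in> sets (PiM {0..<Suc n} (\<lambda>_. \<mu>))" by measurable
  finally have A: "?A \<in> sets (PiM {0..<Suc n} (\<lambda>_. \<mu>))" .
  have iA: "(indicator ?A (restrict \<omega> {0..<Suc n}) :: ennreal) = indicator {\<omega>. \<forall>i<Suc n. \<omega> i \<in> B} \<omega>"
    if "\<omega> \<in> space ?L" for \<omega>
    using that by (auto simp: indicator_def space_markov_law[OF \<mu> K prob_K] space_PiM)
  have "(\<integral>\<^sup>+\<omega>. indicator {\<omega>. \<forall>i<Suc n. \<omega> i \<in> B} \<omega> * f (\<omega> (Suc n)) \<partial>?L) =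
      (\<integral>\<^sup>+\<omega>. indicator ?A (restrict \<omega> {0..<Suc n}) * f (\<omega> (Suc n)) \<partial>?L)"
    using iA by (intro nn_integral_cong) simp
  also have "\<dots> = (\<integral>\<^sup>+\<omega>. indicator ?A (restrict \<omega> {0..<Suc n}) * (\<integral>\<^sup>+y. f y \<partial>K (\<omega> n)) \<partial>?L)"
    by (rule nn_integral_markov_law_step[OF \<mu> K prob_K A Suc.prems])
  \<comment> \<open>The survival condition at time \<open>n\<close> moves from the event into
    \<open>killed_op\<close>; the remaining event concerns only times before
    \<open>n\<close>.\<close>
  also have "\<dots> = (\<integral>\<^sup>+\<omega>. indicator {\<omega>. \<forall>i<n. \<omega> i \<in> B} \<omega> * killed_op K B f (\<omega> n) \<partial>?L)"
    by (intro nn_integral_cong, subst iA, assumption)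
      (auto simp: killed_op_def indicator_def less_Suc_eq)
  also have "\<dots> = (\<integral>\<^sup>+z. (killed_op K B ^^ n) (killed_op K B f) z \<partial>\<mu>)"
    by (intro Suc.IH measurable_killed_op K B Suc.prems)
  \<comment> \<open>The new factor arises innermost, whereas the power \<open>Suc n\<close> adds it
    outermost; \<open>funpow_swap1\<close> reconciles the two.\<close>
  finally show ?case by (simp add: funpow_swap1)
qed

section \<open>First-step analysis of the shrinkage chain\<close>

lemma nn_integral_shrink_init:
  assumes [measurable]: "f \<in> borel_measurable borel"
  shows "(\<integral>\<^sup>+z. f z \<partial>shrink_init) =
    (\<integral>\<^sup>+\<gamma>. indicator {0..<2 * pi} \<gamma> * f (\<gamma>, \<gamma>, \<gamma>) \<partial>lborel) / ennreal (2 * pi)"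
proof -
  have m[measurable]: "(\<lambda>\<gamma>::real. (\<gamma>, \<gamma>, \<gamma>)) \<in> borel_measurable borel"
    by (intro borel_measurable_continuous_onI continuous_intros)
  have "(\<integral>\<^sup>+z. f z \<partial>shrink_init) =
      (\<integral>\<^sup>+\<gamma>. (\<integral>\<^sup>+z. f z \<partial>return borel (\<gamma>, \<gamma>, \<gamma>)) \<partial>uniform_measure lborel {0..<2 * pi})"
    unfolding shrink_init_def by (rule nn_integral_bind[OF assms measurable_diag])
  also have "\<dots> = (\<integral>\<^sup>+\<gamma>. f (\<gamma>, \<gamma>, \<gamma>) \<partial>uniform_measure lborel {0..<2 * pi})"
    by (intro nn_integral_cong nn_integral_return) auto
  also have "\<dots> = (\<integral>\<^sup>+\<gamma>. f (\<gamma>, \<gamma>, \<gamma>) * indicator {0..<2 * pi} \<gamma> \<partial>lborel) / emeasure lborel {0..<2 * pi}"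
    by (rule nn_integral_uniform_measure) measurable
  finally show ?thesis by (simp add: mult.commute)
qed

text \<open>By \<open>circ_split\<close> exactly one of the two indicators in the kernel is 1 on
  \<open>shrink_states \<theta>\<close>, so a step keeps one piece of the interval and draws the
  next angle uniformly from it. The pair \<open>(a', b')\<close> names the kept piece and treats
  both cases at once.\<close>

lemma nn_integral_shrink_step:
  fixes f :: "real \<times> real \<times> real \<Rightarrow> ennreal"
  assumes z: "(\<gamma>, a, b) \<in> shrink_states \<theta>" and f[measurable]: "f \<in> borel_measurable borel"
    and ab: "(a', b') = (if \<gamma> \<in> circ_J a \<theta> then (\<gamma>, b) else (a, \<gamma>))"
  shows "(\<integral>\<^sup>+y. f y \<partial>shrink_step \<theta> (\<gamma>, a, b)) =
    (\<integral>\<^sup>+x. indicator (circ_I a' b') x * f (x, a', b') \<partial>lborel) / emeasure lborel (circ_I a' b')"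
proof -
  let ?U = "uniform_measure lborel (circ_I a' b')"
  have [measurable]: "(\<lambda>x::real. (x, a', b')) \<in> borel_measurable borel"
    by (intro borel_measurable_continuous_onI continuous_intros)
  have "shrink_step \<theta> (\<gamma>, a, b) = distr ?U borel (\<lambda>x. (x, a', b'))"
  proof (rule measure_eqI)
    fix D :: "(real \<times> real \<times> real) set" assume "D \<in> sets (shrink_step \<theta> (\<gamma>, a, b))"
    then have D[measurable]: "D \<in> sets borel" by simp
    have "emeasure (shrink_step \<theta> (\<gamma>, a, b)) D = emeasure (?U \<Otimes>\<^sub>M return borel (a', b')) D"
      using circ_split[OF z] ab by (auto simp: emeasure_shrink_step[OF z D] split: if_splits)
    also have "\<dots> = (\<integral>\<^sup>+x. indicator D (x, a', b') * indicator (circ_I a' b') x \<partial>lborel) /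
        emeasure lborel (circ_I a' b')"
      by (subst emeasure_step_component[OF D sets_circ_I]) (simp add: mult.commute)
    also have "\<dots> = (\<integral>\<^sup>+x. indicator D (x, a', b') \<partial>?U)"
      by (rule nn_integral_uniform_measure[symmetric]) measurable
    also have "\<dots> = (\<integral>\<^sup>+y. indicator D y \<partial>distr ?U borel (\<lambda>x. (x, a', b')))"
      by (rule nn_integral_distr[symmetric]) measurable
    finally show "emeasure (shrink_step \<theta> (\<gamma>, a, b)) D = emeasure (distr ?U borel (\<lambda>x. (x, a', b'))) D"
      by simp
  qed simp
  then have "(\<integral>\<^sup>+y. f y \<partial>shrink_step \<theta> (\<gamma>, a, b)) = (\<integral>\<^sup>+x. f (x, a', b') \<partial>?U)"
    by (simp add: nn_integral_distr)
  also have "\<dots> = (\<integral>\<^sup>+x. f (x, a', b') * indicator (circ_I a' b') x \<partial>lborel) / emeasure lborel (circ_I a' b')"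
    by (rule nn_integral_uniform_measure) measurable
  finally show ?thesis by (simp add: mult.commute)
qed

text \<open>
  The probability that the chain, when its next angle is drawn uniformly from \<open>I(a, b)\<close>, first
  enters \<open>S\<close> after \<open>n\<close> further rejections, and does so in \<open>F\<close>.
\<close>

primrec first_hit :: "real set \<Rightarrow> real set \<Rightarrow> nat \<Rightarrow> real \<Rightarrow> real \<Rightarrow> real \<Rightarrow> ennreal" where
  "first_hit S F 0 \<theta> a b =
    (\<integral>\<^sup>+x. indicator (circ_I a b) x * indicator F x \<partial>lborel) / emeasure lborel (circ_I a b)"
| "first_hit S F (Suc n) \<theta> a b =
    (\<integral>\<^sup>+x. indicator (circ_I a b) x * (indicator (- S) x *
        (if x \<in> circ_J a \<theta> then first_hit S F n \<theta> x b else first_hit S F n \<theta> a x)) \<partial>lborel) /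
    emeasure lborel (circ_I a b)"

lemma measurable_emeasure_circ_I[measurable (raw)]:
  assumes [measurable]: "g \<in> borel_measurable M" "h \<in> borel_measurable M"
  shows "(\<lambda>x. emeasure lborel (circ_I (g x) (h x))) \<in> borel_measurable M"
proof -
  have *: "emeasure lborel (circ_I a b) = (\<integral>\<^sup>+x. indicator (circ_I a b) x \<partial>lborel)" for a b
    by simp
  show ?thesis unfolding * by measurable
qed

text \<open>Joint measurability in \<open>\<theta>\<close> and both endpoints is what the later
  exchange of the integrals over \<open>\<theta>\<close> and the rejected angle requires.\<close>

lemma measurable_first_hit[measurable (raw)]:
  assumes [measurable]: "S \<in> sets borel" "F \<in> sets borel"
    and "f \<in> borel_measurable M" "g \<in> borel_measurable M" "h \<in> borel_measurable M"
  shows "(\<lambda>x. first_hit S F n (f x) (g x) (h x)) \<in> borel_measurable M"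
proof -
  have "(\<lambda>(\<theta>, a, b). first_hit S F n \<theta> a b) \<in> borel_measurable (borel \<Otimes>\<^sub>M borel \<Otimes>\<^sub>M borel)"
  proof (induction n)
    case 0
    show ?case unfolding first_hit.simps by measurable
  next
    case (Suc n)
    note [measurable] = Suc
    \<comment> \<open>The recursive calls stand under an integral and have the integration variable
      as an endpoint, so the induction hypothesis is restated for functions on the product of the
      triples with that variable.\<close>
    have [measurable]: "(\<lambda>x. first_hit S F n (f x) (g x) (h x)) \<in> borel_measurable N"
      if [measurable]: "f \<in> borel_measurable N" "g \<in> borel_measurable N" "h \<in> borel_measurable N"
      for f g h and N :: "((real \<times> real \<times> real) \<times> real) measure"
      using measurable_compose[of "\<lambda>x. (f x, g x, h x)" N, OF _ Suc] by simp
    show ?case unfolding first_hit.simps by measurable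
  qed
  from measurable_compose[of "\<lambda>x. (f x, g x, h x)" M, OF _ this] assms(3-) show ?thesis
    by simp
qed

lemma funpow_killed_op_shrink_measurable:
  assumes "B \<in> sets borel" "f \<in> borel_measurable borel"
  shows "(killed_op (shrink_step \<theta>) B ^^ n) f \<in> borel_measurable borel"
  using assms by (induction n) (auto intro: measurable_killed_op measurable_shrink_step)

text \<open>This links the recursion to the chain. The invariant
  \<open>\<theta> \<in> circ_I a b\<close> passes to the kept piece, and since
  \<open>\<theta> \<in> S\<close> a rejected angle never equals \<open>\<theta>\<close>; so every
  rejected state lies in \<open>shrink_states \<theta>\<close>, where the kernel is the genuine
  shrinkage step.\<close>

lemma first_hit_eq_killed_op:
  fixes S F :: "real set"
  assumes S[measurable]: "S \<in> sets borel" and F[measurable]: "F \<in> sets borel"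
    and \<theta>: "\<theta> \<in> S" "\<theta> \<in> circ_I a b" and ab: "a \<in> {0..<2 * pi}" "b \<in> {0..<2 * pi}"
  shows "first_hit S F n \<theta> a b =
    (\<integral>\<^sup>+x. indicator (circ_I a b) x *
       (killed_op (shrink_step \<theta>) ((- S) \<times> UNIV) ^^ n) (indicator (F \<times> UNIV)) (x, a, b) \<partial>lborel) /
    emeasure lborel (circ_I a b)"
  using \<theta> ab
proof (induction n arbitrary: a b)
  case 0
  then show ?case by (simp add: indicator_def)
next
  case (Suc n)
  let ?T = "killed_op (shrink_step \<theta>) ((- S) \<times> UNIV)"
  let ?f = "(?T ^^ n) (indicator (F \<times> UNIV))"
  have SB: "(- S) \<times> UNIV \<in> sets (borel :: (real \<times> real \<times> real) measure)"
    and FB: "F \<times> UNIV \<in> sets (borel :: (real \<times> real \<times> real) measure)"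
    unfolding sets_borel_triple by measurable
  have f: "?f \<in> borel_measurable borel"
    by (intro funpow_killed_op_shrink_measurable SB borel_measurable_indicator FB)
  \<comment> \<open>The integrands agree pointwise: outside \<open>circ_I a b\<close> and on
    \<open>S\<close> both vanish.\<close>
  have "indicator (circ_I a b) x * (?T ^^ Suc n) (indicator (F \<times> UNIV)) (x, a, b) =
      indicator (circ_I a b) x * (indicator (- S) x *
        (if x \<in> circ_J a \<theta> then first_hit S F n \<theta> x b else first_hit S F n \<theta> a x))" for x
  proof (cases "x \<in> circ_I a b \<and> x \<notin> S")
    case True
    then have x: "x \<in> {0..<2 * pi}" "x \<noteq> \<theta>"
      using Suc.prems by (auto simp: circ_I_def split: if_splits)
    then have z: "(x, a, b) \<in> shrink_states \<theta>"
      using True Suc.prems by (auto simp: shrink_states_def)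
    show ?thesis
    proof (cases "x \<in> circ_J a \<theta>")
      case J: True
      have "\<theta> \<in> circ_I x b"
        using J True Suc.prems x by (auto simp: circ_I_def circ_J_def split: if_splits)
      then show ?thesis
        using nn_integral_shrink_step[OF z f, of x b] J True x Suc.IH[of x b] Suc.prems
        by (simp add: funpow_killed_op_Suc del: funpow.simps)
    next
      case J: False
      \<comment> \<open>This includes \<open>a = \<theta>\<close>, where
        \<open>circ_J a \<theta>\<close> is empty: the piece \<open>circ_I a x\<close> contains its
        left endpoint \<open>a\<close>.\<close>
      have "\<theta> \<in> circ_I a x"
        using J True Suc.prems x by (auto simp: circ_I_def circ_J_def split: if_splits)
      then show ?thesis
        using nn_integral_shrink_step[OF z f, of a x] J True x Suc.IH[of a x] Suc.prems
        by (simp add: funpow_killed_op_Suc del: funpow.simps)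
    qed
  next
    case False
    then show ?thesis by (auto simp: funpow_killed_op_Suc indicator_def simp del: funpow.simps)
  qed
  then show ?case by (simp only: first_hit.simps)
qed

text \<open>
  The first step is special: from \<open>(\<gamma>, \<gamma>, \<gamma>)\<close> the chain moves to the degenerate interval
  \<open>I(\<gamma>, \<gamma>)\<close>, the whole circle.
\<close>

definition hit_at :: "real set \<Rightarrow> real set \<Rightarrow> nat \<Rightarrow> real \<Rightarrow> ennreal" where
  "hit_at S F n \<theta> = (case n of
      0 \<Rightarrow> (\<integral>\<^sup>+\<gamma>. indicator {0..<2 * pi} \<gamma> * indicator F \<gamma> \<partial>lborel) / ennreal (2 * pi)
    | Suc m \<Rightarrow> (\<integral>\<^sup>+\<gamma>. indicator ({0..<2 * pi} - S) \<gamma> * first_hit S F m \<theta> \<gamma> \<gamma> \<partial>lborel) / ennreal (2 * pi))"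

lemma measurable_hit_at[measurable]:
  assumes [measurable]: "S \<in> sets borel" "F \<in> sets borel"
  shows "hit_at S F n \<in> borel_measurable borel"
  unfolding hit_at_def[abs_def] by (cases n) simp_all

text \<open>The first angle is integrated out separately, because it is also both endpoints of its
  state and is not drawn from a given interval. From the second angle on,
  \<open>first_hit_eq_killed_op\<close> applies.\<close>

lemma shrink_law_killed:
  assumes S[measurable]: "S \<in> sets borel" and F[measurable]: "F \<in> sets borel"
    and \<theta>: "\<theta> \<in> S" "S \<subseteq> {0..<2 * pi}"
  shows "(\<integral>\<^sup>+\<omega>. indicator {\<omega>. \<forall>i<n. \<omega> i \<in> (- S) \<times> UNIV} \<omega> * indicator (F \<times> UNIV) (\<omega> n) \<partial>shrink_law \<theta>)
    = hit_at S F n \<theta>"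
proof -
  let ?T = "killed_op (shrink_step \<theta>) ((- S) \<times> UNIV)"
  have SB: "(- S) \<times> UNIV \<in> sets (borel :: (real \<times> real \<times> real) measure)"
    and FB: "F \<times> UNIV \<in> sets (borel :: (real \<times> real \<times> real) measure)"
    unfolding sets_borel_triple by measurable
  have f: "(?T ^^ n) (indicator (F \<times> UNIV)) \<in> borel_measurable borel" for n
    by (intro funpow_killed_op_shrink_measurable SB borel_measurable_indicator FB)
  have SI: "(- S) \<times> UNIV \<in> sets shrink_init"
    and FI: "indicator (F \<times> UNIV) \<in> borel_measurable shrink_init"
    using SB FB by (auto cong: measurable_cong_sets)
  have "(\<integral>\<^sup>+\<omega>. indicator {\<omega>. \<forall>i<n. \<omega> i \<in> (- S) \<times> UNIV} \<omega> * indicator (F \<times> UNIV) (\<omega> n) \<partial>shrink_law \<theta>) =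
      (\<integral>\<^sup>+z. (?T ^^ n) (indicator (F \<times> UNIV)) z \<partial>shrink_init)"
    unfolding shrink_law_def by (rule nn_integral_markov_law_killed[OF shrink_chain_wf SI FI])
  also have "\<dots> = (\<integral>\<^sup>+\<gamma>. indicator {0..<2 * pi} \<gamma> *
      (?T ^^ n) (indicator (F \<times> UNIV)) (\<gamma>, \<gamma>, \<gamma>) \<partial>lborel) / ennreal (2 * pi)"
    by (rule nn_integral_shrink_init[OF f])
  also have "\<dots> = hit_at S F n \<theta>"
  proof (cases n)
    case 0
    then show ?thesis by (simp add: hit_at_def indicator_def)
  next
    case (Suc m)
    have "indicator {0..<2 * pi} \<gamma> * (?T ^^ n) (indicator (F \<times> UNIV)) (\<gamma>, \<gamma>, \<gamma>) =
        indicator ({0..<2 * pi} - S) \<gamma> * first_hit S F m \<theta> \<gamma> \<gamma>" for \<gamma>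
    proof (cases "\<gamma> \<in> {0..<2 * pi} - S")
      case True
      have I: "circ_I \<gamma> \<gamma> = {0..<2 * pi}" by (simp add: circ_I_def)
      have z: "(\<gamma>, \<gamma>, \<gamma>) \<in> shrink_states \<theta>"
        using True \<theta> by (auto simp: shrink_states_def I)
      \<comment> \<open>Both branches of the step lead to the endpoints
        \<open>(\<gamma>, \<gamma>)\<close>; this selects the first one.\<close>
      have "\<gamma> \<in> circ_J \<gamma> \<theta>"
        using True \<theta> by (auto simp: circ_J_def circ_I_def)
      then show ?thesis
        using nn_integral_shrink_step[OF z f, of \<gamma> \<gamma> m] True \<theta>
          first_hit_eq_killed_op[OF S F, of \<theta> \<gamma> \<gamma> m]
        by (simp add: Suc funpow_killed_op_Suc I subset_iff del: funpow.simps)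
    next
      case False
      then show ?thesis by (auto simp: Suc funpow_killed_op_Suc indicator_def simp del: funpow.simps)
    qed
    then show ?thesis by (simp add: Suc hit_at_def)
  qed
  finally show ?thesis .
qed

section \<open>Decomposition of the shrinkage kernel by the hitting time\<close>

lemma shrink_tau_first_hit:
  assumes "F \<subseteq> S"
  shows "shrink_Gamma (the_enat (shrink_tau S \<omega>)) \<omega> \<in> F \<and> shrink_tau S \<omega> < \<infinity> \<longleftrightarrow>
    (\<exists>n. (\<forall>i<n. fst (\<omega> i) \<notin> S) \<and> fst (\<omega> n) \<in> F)" (is "?L \<longleftrightarrow> ?R")
proof -
  \<comment> \<open>Time starts at 1: a first hit at coordinate \<open>n\<close> means hitting time
    n + 1, and \<open>shrink_Gamma (Suc n)\<close> reads coordinate \<open>n\<close> again.\<close>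
  have tau: "shrink_tau S \<omega> = enat (Suc n)" if "\<forall>i<n. fst (\<omega> i) \<notin> S" "fst (\<omega> n) \<in> S" for n
    unfolding shrink_tau_def
  proof (rule Inf_eqI)
    fix y assume "\<And>x. x \<in> {enat n |n. 1 \<le> n \<and> shrink_Gamma n \<omega> \<in> S} \<Longrightarrow> y \<le> x"
    then show "y \<le> enat (Suc n)" using that by (auto simp: shrink_Gamma_def)
  next
    fix y assume "y \<in> {enat n |n. 1 \<le> n \<and> shrink_Gamma n \<omega> \<in> S}"
    then obtain m where m: "y = enat m" "1 \<le> m" "fst (\<omega> (m - 1)) \<in> S" by (auto simp: shrink_Gamma_def)
    then have "\<not> m - 1 < n" using that by auto
    then show "enat (Suc n) \<le> y" using m by auto
  qed
  show ?thesis
  proof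
    assume ?R
    then obtain n where n: "\<forall>i<n. fst (\<omega> i) \<notin> S" "fst (\<omega> n) \<in> F" by auto
    then show ?L using tau[of n] assms by (auto simp: shrink_Gamma_def)
  next
    assume L: ?L
    have "\<exists>n. fst (\<omega> n) \<in> S"
    proof (rule ccontr)
      assume "\<not> ?thesis"
      \<comment> \<open>Without a hit the infimum is over the empty set, hence infinite.\<close>
      then have "shrink_tau S \<omega> = \<infinity>" by (simp add: shrink_tau_def shrink_Gamma_def top_enat_def)
      with L show False by simp
    qed
    then obtain n where n: "\<forall>i<n. fst (\<omega> i) \<notin> S" "fst (\<omega> n) \<in> S"
      using exists_least_iff[of "\<lambda>n. fst (\<omega> n) \<in> S"] by auto
    then show ?R using tau[of n] L by (auto simp: shrink_Gamma_def)
  qed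
qed

lemma shrink_kernel_eq_suminf:
  assumes S[measurable]: "S \<in> sets borel" and F[measurable]: "F \<in> sets borel"
    and "F \<subseteq> S" "\<theta> \<in> S" "S \<subseteq> {0..<2 * pi}"
  shows "shrink_kernel S \<theta> F = (\<Sum>n. hit_at S F n \<theta>)"
proof -
  let ?L = "shrink_law \<theta>"
  \<comment> \<open>Here \<open>n\<close> rejections are followed by an angle in \<open>F\<close>.
    As \<open>F \<subseteq> S\<close>, this fixes the hitting time, so the events are
    disjoint.\<close>
  let ?E = "\<lambda>n. {\<omega> \<in> space ?L. (\<forall>i\<in>{..<n}. \<omega> i \<in> (- S) \<times> UNIV) \<and> \<omega> n \<in> F \<times> UNIV}"
  have setsL: "sets ?L = sets (PiM UNIV (\<lambda>_. shrink_init))"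
    unfolding shrink_law_def by (rule sets_markov_law[OF shrink_chain_wf])
  have [measurable]: "(\<lambda>\<omega>. \<omega> i) \<in> measurable ?L borel" for i
    using measurable_component_singleton[of i UNIV "\<lambda>_. shrink_init"]
    by (simp add: measurable_cong_sets[OF setsL refl] measurable_cong_sets[OF refl sets_shrink_init])
  have [measurable]: "(- S) \<times> UNIV \<in> sets (borel :: (real \<times> real \<times> real) measure)"
    "F \<times> UNIV \<in> sets (borel :: (real \<times> real \<times> real) measure)"
    unfolding sets_borel_triple by measurable
  have E[measurable]: "?E n \<in> sets ?L" for n by measurable
  have disj: "disjoint_family ?E"
    unfolding disjoint_family_on_def
  proof (intro ballI impI)
    fix m n :: nat assume "m \<noteq> n"
    then show "?E m \<inter> ?E n = {}"
      using \<open>F \<subseteq> S\<close> by (cases m n rule: linorder_cases) (auto simp: mem_Times_iff)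
  qed
  have "shrink_kernel S \<theta> F = emeasure ?L (\<Union>n. ?E n)"
    unfolding shrink_kernel_def shrink_tau_first_hit[OF \<open>F \<subseteq> S\<close>]
    by (rule arg_cong[where f="emeasure ?L"]) (auto simp: mem_Times_iff)
  also have "\<dots> = (\<Sum>n. emeasure ?L (?E n))"
    using disj by (intro suminf_emeasure[symmetric]) (auto simp del: Compl_Times_UNIV2)
  also have "\<dots> = (\<Sum>n. hit_at S F n \<theta>)"
  proof (rule suminf_cong)
    fix n
    have "emeasure ?L (?E n) = (\<integral>\<^sup>+\<omega>. indicator (?E n) \<omega> \<partial>?L)"
      by (rule nn_integral_indicator[symmetric]) (rule E)
    also have "\<dots> = (\<integral>\<^sup>+\<omega>. indicator {\<omega>. \<forall>i<n. \<omega> i \<in> (- S) \<times> UNIV} \<omega> * indicator (F \<times> UNIV) (\<omega> n) \<partial>?L)"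
      by (intro nn_integral_cong) (auto simp: indicator_def)
    also have "\<dots> = hit_at S F n \<theta>"
      by (rule shrink_law_killed) fact+
    finally show "emeasure ?L (?E n) = hit_at S F n \<theta>" .
  qed
  finally show ?thesis .
qed

section \<open>Symmetry\<close>

text \<open>The chain keeps the piece that contains \<open>\<theta>\<close>. The case
  \<open>\<gamma> = a\<close> is excluded because \<open>circ_I a a\<close> is the whole circle and
  not an empty arc.\<close>

lemma circ_I_split:
  assumes "\<gamma> \<in> circ_I a b" "\<gamma> \<noteq> a" "\<theta> \<noteq> \<gamma>" "a \<in> {0..<2 * pi}" "b \<in> {0..<2 * pi}"
  shows "\<theta> \<in> circ_I a b \<and> \<gamma> \<in> circ_J a \<theta> \<longleftrightarrow> \<theta> \<in> circ_I \<gamma> b"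
    and "\<theta> \<in> circ_I a b \<and> \<gamma> \<notin> circ_J a \<theta> \<longleftrightarrow> \<theta> \<in> circ_I a \<gamma>"
  using assms by (auto simp: circ_I_def circ_J_def split: if_splits)

text \<open>All arcs are treated at once, since a rejection at \<open>\<gamma>\<close> leads to the
  arcs \<open>circ_I \<gamma> b\<close> and \<open>circ_I a \<gamma>\<close>.\<close>

lemma first_hit_symmetric:
  assumes S[measurable]: "S \<in> sets borel"
    and F[measurable]: "F \<in> sets borel" and G[measurable]: "G \<in> sets borel"
    and FG: "F \<subseteq> S" "G \<subseteq> S" and ab: "a \<in> {0..<2 * pi}" "b \<in> {0..<2 * pi}"
  shows "(\<integral>\<^sup>+\<theta>. indicator (G \<inter> circ_I a b) \<theta> * first_hit S F n \<theta> a b \<partial>lborel) =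
    (\<integral>\<^sup>+\<theta>. indicator (F \<inter> circ_I a b) \<theta> * first_hit S G n \<theta> a b \<partial>lborel)"
  using ab
proof (induction n arbitrary: a b)
  case 0
  \<comment> \<open>With no rejection \<open>first_hit\<close> does not depend on
    \<open>\<theta>\<close>, so the integral factors.\<close>
  have *: "(\<integral>\<^sup>+x. indicator (circ_I a b) x * indicator X x \<partial>lborel) = emeasure lborel (X \<inter> circ_I a b)"
    if "X \<in> sets borel" for X :: "real set"
    using that by (simp add: indicator_inter_arith[symmetric] Int_commute)
  show ?case
    by (simp only: first_hit.simps *[OF F] *[OF G])
      (simp add: nn_integral_multc, simp add: ennreal_times_divide mult.commute)
next
  case (Suc n)
  let ?c = "emeasure lborel (circ_I a b)"
  \<comment> \<open>General \<open>X\<close> and \<open>Y\<close> let this serve both sides of the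
    symmetry. \<open>Y \<subseteq> S\<close> keeps \<open>\<theta>\<close> distinct from every
    rejected \<open>\<gamma>\<close>.\<close>
  have swap: "(\<integral>\<^sup>+\<theta>. indicator (Y \<inter> circ_I a b) \<theta> * first_hit S X (Suc n) \<theta> a b \<partial>lborel) =
      (\<integral>\<^sup>+\<gamma>. indicator (circ_I a b - S) \<gamma> *
        ((\<integral>\<^sup>+\<theta>. indicator (Y \<inter> circ_I \<gamma> b) \<theta> * first_hit S X n \<theta> \<gamma> b \<partial>lborel) +
         (\<integral>\<^sup>+\<theta>. indicator (Y \<inter> circ_I a \<gamma>) \<theta> * first_hit S X n \<theta> a \<gamma> \<partial>lborel)) \<partial>lborel) / ?c"
    if [measurable]: "X \<in> sets borel" "Y \<in> sets borel" and "Y \<subseteq> S" for X Y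
  proof -
    let ?h = "\<lambda>\<theta> \<gamma>. indicator (Y \<inter> circ_I a b) \<theta> * (indicator (circ_I a b) \<gamma> * (indicator (- S) \<gamma> *
        (if \<gamma> \<in> circ_J a \<theta> then first_hit S X n \<theta> \<gamma> b else first_hit S X n \<theta> a \<gamma>)))"
    have "(\<integral>\<^sup>+\<theta>. indicator (Y \<inter> circ_I a b) \<theta> * first_hit S X (Suc n) \<theta> a b \<partial>lborel) =
        (\<integral>\<^sup>+\<theta>. (\<integral>\<^sup>+\<gamma>. ?h \<theta> \<gamma> \<partial>lborel) / ?c \<partial>lborel)"
      by (intro nn_integral_cong) (simp add: nn_integral_cmult ennreal_times_divide)
    also have "\<dots> = (\<integral>\<^sup>+\<theta>. (\<integral>\<^sup>+\<gamma>. ?h \<theta> \<gamma> \<partial>lborel) \<partial>lborel) / ?c"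
      by (rule nn_integral_divide) measurable
    also have "(\<integral>\<^sup>+\<theta>. (\<integral>\<^sup>+\<gamma>. ?h \<theta> \<gamma> \<partial>lborel) \<partial>lborel) = (\<integral>\<^sup>+\<gamma>. (\<integral>\<^sup>+\<theta>. ?h \<theta> \<gamma> \<partial>lborel) \<partial>lborel)"
      by (rule lborel_pair.Fubini') measurable
    also have "\<dots> = (\<integral>\<^sup>+\<gamma>. indicator (circ_I a b - S) \<gamma> *
        ((\<integral>\<^sup>+\<theta>. indicator (Y \<inter> circ_I \<gamma> b) \<theta> * first_hit S X n \<theta> \<gamma> b \<partial>lborel) +
         (\<integral>\<^sup>+\<theta>. indicator (Y \<inter> circ_I a \<gamma>) \<theta> * first_hit S X n \<theta> a \<gamma> \<partial>lborel)) \<partial>lborel)"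
    \<comment> \<open>The splitting by \<open>circ_I_split\<close> can fail only at
      \<open>\<gamma> = a\<close>, a null set.\<close>
    proof (rule nn_integral_cong_AE)
      show "AE \<gamma> in lborel. (\<integral>\<^sup>+\<theta>. ?h \<theta> \<gamma> \<partial>lborel) = indicator (circ_I a b - S) \<gamma> *
          ((\<integral>\<^sup>+\<theta>. indicator (Y \<inter> circ_I \<gamma> b) \<theta> * first_hit S X n \<theta> \<gamma> b \<partial>lborel) +
           (\<integral>\<^sup>+\<theta>. indicator (Y \<inter> circ_I a \<gamma>) \<theta> * first_hit S X n \<theta> a \<gamma> \<partial>lborel))"
        using AE_lborel_singleton[of a]
      proof eventually_elim
        case (elim \<gamma>)
        show ?case
        proof (cases "\<gamma> \<in> circ_I a b - S")
          case True
          have "?h \<theta> \<gamma> = indicator (Y \<inter> circ_I \<gamma> b) \<theta> * first_hit S X n \<theta> \<gamma> b +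
              indicator (Y \<inter> circ_I a \<gamma>) \<theta> * first_hit S X n \<theta> a \<gamma>" for \<theta>
          proof (cases "\<theta> \<in> Y")
            case \<theta>: True
            then have "\<theta> \<noteq> \<gamma>" using True \<open>Y \<subseteq> S\<close> by auto
            from circ_I_split[OF _ elim this Suc.prems] True \<theta>
            show ?thesis by (auto simp: indicator_def)
          qed simp
          then show ?thesis using True by (simp add: nn_integral_add)
        qed (auto simp: indicator_def)
      qed
    qed
    finally show ?thesis .
  qed
  show ?case
    unfolding swap[OF F G FG(2)] swap[OF G F FG(1)]
  proof (intro arg_cong2[where f="(/)"] nn_integral_cong refl)
    fix \<gamma>
    show "indicator (circ_I a b - S) \<gamma> *
        ((\<integral>\<^sup>+\<theta>. indicator (G \<inter> circ_I \<gamma> b) \<theta> * first_hit S F n \<theta> \<gamma> b \<partial>lborel) +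
         (\<integral>\<^sup>+\<theta>. indicator (G \<inter> circ_I a \<gamma>) \<theta> * first_hit S F n \<theta> a \<gamma> \<partial>lborel)) =
        indicator (circ_I a b - S) \<gamma> *
        ((\<integral>\<^sup>+\<theta>. indicator (F \<inter> circ_I \<gamma> b) \<theta> * first_hit S G n \<theta> \<gamma> b \<partial>lborel) +
         (\<integral>\<^sup>+\<theta>. indicator (F \<inter> circ_I a \<gamma>) \<theta> * first_hit S G n \<theta> a \<gamma> \<partial>lborel))"
    \<comment> \<open>The induction hypothesis asks the new endpoint to lie in
      \<open>{0..<2 * pi}\<close>, which holds on \<open>circ_I a b\<close>; elsewhere the indicator
      is zero.\<close>
    proof (cases "\<gamma> \<in> circ_I a b")
      case True
      then have "\<gamma> \<in> {0..<2 * pi}" using Suc.prems by (auto simp: circ_I_def split: if_splits)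
      then show ?thesis using Suc.IH Suc.prems by simp
    qed simp
  qed
qed

text \<open>For each rejected first angle \<open>\<gamma>\<close> the claim is
  \<open>first_hit_symmetric\<close> on the whole circle cut open at \<open>\<gamma>\<close>, and
  this is averaged over \<open>\<gamma>\<close>. For an accepted first angle, its law does not
  depend on \<open>\<theta>\<close>.\<close>

lemma hit_at_symmetric:
  assumes S[measurable]: "S \<in> sets borel"
    and F[measurable]: "F \<in> sets borel" and G[measurable]: "G \<in> sets borel"
    and FG: "F \<subseteq> S" "G \<subseteq> S" and S2: "S \<subseteq> {0..<2 * pi}"
  shows "(\<integral>\<^sup>+\<theta>. indicator G \<theta> * hit_at S F n \<theta> \<partial>lborel) = (\<integral>\<^sup>+\<theta>. indicator F \<theta> * hit_at S G n \<theta> \<partial>lborel)"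
proof (cases n)
  case 0
  have *: "(\<integral>\<^sup>+x. indicator {0..<2 * pi} x * indicator X x \<partial>lborel) = emeasure lborel X"
    if "X \<in> sets borel" "X \<subseteq> S" for X :: "real set"
    using that S2 by (simp add: indicator_inter_arith[symmetric] Int_absorb1)
  show ?thesis
    by (simp only: 0 hit_at_def nat.case *[OF F FG(1)] *[OF G FG(2)])
      (simp add: nn_integral_multc, simp add: ennreal_times_divide mult.commute)
next
  case (Suc m)
  have swap: "(\<integral>\<^sup>+\<theta>. indicator Y \<theta> * hit_at S X n \<theta> \<partial>lborel) =
      (\<integral>\<^sup>+\<gamma>. indicator ({0..<2 * pi} - S) \<gamma> *
        (\<integral>\<^sup>+\<theta>. indicator (Y \<inter> circ_I \<gamma> \<gamma>) \<theta> * first_hit S X m \<theta> \<gamma> \<gamma> \<partial>lborel) \<partial>lborel) / ennreal (2 * pi)"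
    if [measurable]: "X \<in> sets borel" "Y \<in> sets borel" and "Y \<subseteq> S" for X Y
  proof -
    \<comment> \<open>Intersecting with the whole circle gives the inner integral the shape of
      \<open>first_hit_symmetric\<close>.\<close>
    have Y: "Y \<inter> circ_I \<gamma> \<gamma> = Y" for \<gamma>
      using that S2 by (auto simp: circ_I_def)
    let ?h = "\<lambda>\<theta> \<gamma>. indicator Y \<theta> * (indicator ({0..<2 * pi} - S) \<gamma> * first_hit S X m \<theta> \<gamma> \<gamma>)"
    have "(\<integral>\<^sup>+\<theta>. indicator Y \<theta> * hit_at S X n \<theta> \<partial>lborel) =
        (\<integral>\<^sup>+\<theta>. (\<integral>\<^sup>+\<gamma>. ?h \<theta> \<gamma> \<partial>lborel) / ennreal (2 * pi) \<partial>lborel)"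
      by (intro nn_integral_cong) (simp add: Suc hit_at_def nn_integral_cmult ennreal_times_divide)
    also have "\<dots> = (\<integral>\<^sup>+\<theta>. (\<integral>\<^sup>+\<gamma>. ?h \<theta> \<gamma> \<partial>lborel) \<partial>lborel) / ennreal (2 * pi)"
      by (rule nn_integral_divide) measurable
    also have "(\<integral>\<^sup>+\<theta>. (\<integral>\<^sup>+\<gamma>. ?h \<theta> \<gamma> \<partial>lborel) \<partial>lborel) = (\<integral>\<^sup>+\<gamma>. (\<integral>\<^sup>+\<theta>. ?h \<theta> \<gamma> \<partial>lborel) \<partial>lborel)"
      by (rule lborel_pair.Fubini') measurable
    also have "\<dots> = (\<integral>\<^sup>+\<gamma>. indicator ({0..<2 * pi} - S) \<gamma> *
        (\<integral>\<^sup>+\<theta>. indicator Y \<theta> * first_hit S X m \<theta> \<gamma> \<gamma> \<partial>lborel) \<partial>lborel)"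
      by (intro nn_integral_cong, subst nn_integral_cmult[symmetric]) (simp_all add: ac_simps)
    finally show ?thesis by (simp add: Y)
  qed
  have "indicator ({0..<2 * pi} - S) \<gamma> *
      (\<integral>\<^sup>+\<theta>. indicator (G \<inter> circ_I \<gamma> \<gamma>) \<theta> * first_hit S F m \<theta> \<gamma> \<gamma> \<partial>lborel) =
    indicator ({0..<2 * pi} - S) \<gamma> *
      (\<integral>\<^sup>+\<theta>. indicator (F \<inter> circ_I \<gamma> \<gamma>) \<theta> * first_hit S G m \<theta> \<gamma> \<gamma> \<partial>lborel)" for \<gamma>
    using first_hit_symmetric[OF S F G FG, of \<gamma> \<gamma> m] by (auto simp: indicator_def)
  then show ?thesis by (simp only: swap[OF F G FG(2)] swap[OF G F FG(1)])
qed

text \<open>On \<open>G\<close>, a subset of \<open>S\<close>, the kernel is the series over the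
  number of rejections, and nonnegativity permits integration term by term. The division by the
  length of \<open>S\<close> is common to both sides of the theorem, so symmetry of each summand is
  enough.\<close>

lemma set_nn_integral_shrink_kernel:
  assumes [measurable]: "S \<in> sets borel" "F \<in> sets borel" "G \<in> sets borel"
    and "F \<subseteq> S" "G \<subseteq> S" "S \<subseteq> {0..<2 * pi}"
  shows "(\<integral>\<^sup>+\<theta>\<in>G. shrink_kernel S \<theta> F \<partial>uniform_measure lborel S) =
    (\<Sum>n. \<integral>\<^sup>+\<theta>. indicator G \<theta> * hit_at S F n \<theta> \<partial>lborel) / emeasure lborel S"
proof -
  have "(\<integral>\<^sup>+\<theta>\<in>G. shrink_kernel S \<theta> F \<partial>uniform_measure lborel S) =
      (\<integral>\<^sup>+\<theta>. (\<Sum>n. indicator G \<theta> * hit_at S F n \<theta>) \<partial>uniform_measure lborel S)"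
    using assms shrink_kernel_eq_suminf[of S F]
    by (intro nn_integral_cong) (auto simp: indicator_def)
  also have "\<dots> = (\<integral>\<^sup>+\<theta>. (\<Sum>n. indicator G \<theta> * hit_at S F n \<theta>) * indicator S \<theta> \<partial>lborel) / emeasure lborel S"
    by (rule nn_integral_uniform_measure) measurable
  also have "(\<integral>\<^sup>+\<theta>. (\<Sum>n. indicator G \<theta> * hit_at S F n \<theta>) * indicator S \<theta> \<partial>lborel) =
      (\<integral>\<^sup>+\<theta>. (\<Sum>n. indicator G \<theta> * hit_at S F n \<theta>) \<partial>lborel)"
    using \<open>G \<subseteq> S\<close> by (intro nn_integral_cong) (auto simp: indicator_def)
  also have "\<dots> = (\<Sum>n. \<integral>\<^sup>+\<theta>. indicator G \<theta> * hit_at S F n \<theta> \<partial>lborel)"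
    by (rule nn_integral_suminf) measurable
  finally show ?thesis .
qed

theorem theorem2p10:
  fixes S F G :: "real set"
  assumes "S \<in> sets borel" and "S \<subseteq> {0..<2 * pi}"
    and "open_on_circle S" and "S \<noteq> {}"
    and "F \<in> sets borel" and "F \<subseteq> S"
    and "G \<in> sets borel" and "G \<subseteq> S"
  shows "(\<integral>\<^sup>+\<theta>\<in>G. shrink_kernel S \<theta> F \<partial>uniform_measure lborel S) =
         (\<integral>\<^sup>+\<theta>\<in>F. shrink_kernel S \<theta> G \<partial>uniform_measure lborel S)"
  using assms by (simp add: set_nn_integral_shrink_kernel hit_at_symmetric[of S F G])

end
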